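(* Let $y_M(\cdot)$ be the multi-resolution approximation ($M$-RA) of $y_0(\cdot)\sim GP(0,C_0)$ on $\mathcal{D}$ based on knots $\mathcal{Q}_0,\ldots,\mathcal{Q}_M$ and modulating functions $T_0,\ldots,T_M$, and let $C_M$ be the covariance function of $y_M(\cdot)$. If $\mathbf{s}\in\mathcal{Q}=\bigcup_{m=0}^M\mathcal{Q}_m$, then the $M$-RA variance at location $\mathbf{s}$ is exact; that is, $C_M(\mathbf{s},\mathbf{s})=C_0(\mathbf{s},\mathbf{s})$.
   Context: Let $\mathcal{D}\subset\mathbb{R}^d$ with $d\ge 1$, let $C_0$ be a positive-definite covariance function on $\mathcal{D}$, and let $y_0(\cdot)\sim GP(0,C_0)$ be a zero-mean Gaussian process on $\mathcal{D}$. Let $M\in\mathbb{N}$. For $m=0,\ldots,M$, $\mathcal{Q}_m=\{\mathbf{q}_{m,1},\ldots,\mathbf{q}_{m,r_m}\}\subset\mathcal{D}$ is a finite set of $r_m$ knots, with $r_0<r_1<\cdots<r_M$. For $m=0,\ldots,M$, the modulating function $T_m:\mathcal{D}\times\mathcal{D}\to[0,1]$ is a symmetric nonnegative-definite function with $T_m(\mathbf{s},\mathbf{s})=1$ for all $\mathbf{s}$ (and equal to $0$ at pairs of locations that are sufficiently far apart, where "far" depends on $m$). For finite sets $A,B\subset\mathcal{D}$ and a function $f$ on $\mathcal{D}\times\mathcal{D}$, $f(A,B)$ denotes the matrix of values of $f$; similarly $f(\mathbf{s},B)$ is a row vector and $f(A,\mathbf{s})$ a column vector. Define recursively $v_0(\mathbf{s}_1,\mathbf{s}_2)=C_0(\mathbf{s}_1,\mathbf{s}_2)\,T_0(\mathbf{s}_1,\mathbf{s}_2)$;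 for $m=0,\ldots,M$, $\mathbf{b}_m(\mathbf{s})'=v_m(\mathbf{s},\mathcal{Q}_m)$ and $\boldsymbol{\Lambda}_m=v_m(\mathcal{Q}_m,\mathcal{Q}_m)$; and for $m=0,\ldots,M-1$, $$v_{m+1}(\mathbf{s}_1,\mathbf{s}_2)=\big(v_m(\mathbf{s}_1,\mathbf{s}_2)-\mathbf{b}_m(\mathbf{s}_1)'\boldsymbol{\Lambda}_m^{-1}\mathbf{b}_m(\mathbf{s}_2)\big)\cdot T_{m+1}(\mathbf{s}_1,\mathbf{s}_2).$$ The matrices $\boldsymbol{\Lambda}_m$ are assumed invertible. The $M$-RA of $y_0(\cdot)$ is the process $y_M(\mathbf{s})=\sum_{m=0}^M \mathbf{b}_m(\mathbf{s})'\boldsymbol{\eta}_m$, where $\boldsymbol{\eta}_0,\ldots,\boldsymbol{\eta}_M$ are independent with $\boldsymbol{\eta}_m\sim\mathcal{N}_{r_m}(\mathbf{0},\boldsymbol{\Lambda}_m^{-1})$. Its covariance function is $C_M(\mathbf{s}_1,\mathbf{s}_2)=\sum_{m=0}^{M} v_m(\mathbf{s}_1,\mathcal{Q}_m)v_m(\mathcal{Q}_m,\mathcal{Q}_m)^{-1}v_m(\mathcal{Q}_m,\mathbf{s}_2)$. *)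

theory Defs
  imports "HOL-Probability.Probability" "Jordan_Normal_Form.Gauss_Jordan_Elimination"
begin

section \<open>Kernels\<close>

definition symmetric_kernel :: "'a set \<Rightarrow> ('a \<Rightarrow> 'a \<Rightarrow> real) \<Rightarrow> bool" where
  "symmetric_kernel D K \<longleftrightarrow> (\<forall>s\<in>D. \<forall>t\<in>D. K s t = K t s)"

definition nonneg_definite_kernel :: "'a set \<Rightarrow> ('a \<Rightarrow> 'a \<Rightarrow> real) \<Rightarrow> bool" where
  "nonneg_definite_kernel D K \<longleftrightarrow> symmetric_kernel D K \<and>
     (\<forall>A c. finite A \<and> A \<subseteq> D \<longrightarrow> 0 \<le> (\<Sum>s\<in>A. \<Sum>t\<in>A. c s * c t * K s t))"

definition pos_definite_kernel :: "'a set \<Rightarrow> ('a \<Rightarrow> 'a \<Rightarrow> real) \<Rightarrow> bool" where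
  "pos_definite_kernel D K \<longleftrightarrow> symmetric_kernel D K \<and>
     (\<forall>A c. finite A \<and> A \<subseteq> D \<and> (\<exists>s\<in>A. c s \<noteq> 0) \<longrightarrow>
        0 < (\<Sum>s\<in>A. \<Sum>t\<in>A. c s * c t * K s t))"

definition modulating_function ::
    "'a::metric_space set \<Rightarrow> ('a \<Rightarrow> 'a \<Rightarrow> real) \<Rightarrow> bool" where
  "modulating_function D T \<longleftrightarrow> nonneg_definite_kernel D T \<and>
     (\<forall>s\<in>D. \<forall>t\<in>D. 0 \<le> T s t \<and> T s t \<le> 1) \<and>
     (\<forall>s\<in>D. T s s = 1) \<and>
     (\<exists>\<delta>>0. \<forall>s\<in>D. \<forall>t\<in>D. \<delta> < dist s t \<longrightarrow> T s t = 0)"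

text \<open>Finite sets of locations are enumerated by distinct lists, so that \<open>f(A, B)\<close> and
  \<open>f(s, B)\<close> are an ordinary matrix and vector.\<close>

definition kernel_mat :: "('a \<Rightarrow> 'a \<Rightarrow> real) \<Rightarrow> 'a list \<Rightarrow> 'a list \<Rightarrow> real mat" where
  "kernel_mat f A B = mat (length A) (length B) (\<lambda>(i, j). f (A ! i) (B ! j))"

definition kernel_vec :: "('a \<Rightarrow> 'a \<Rightarrow> real) \<Rightarrow> 'a \<Rightarrow> 'a list \<Rightarrow> real vec" where
  "kernel_vec f s B = Matrix.vec (length B) (\<lambda>j. f s (B ! j))"

text \<open>The value is unspecified if the matrix is singular.\<close>

definition inv_mat :: "real mat \<Rightarrow> real mat" where
  "inv_mat A = the (mat_inverse A)"


section \<open>Gaussian vectors and processes\<close>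

definition normal_measure :: "real \<Rightarrow> real \<Rightarrow> real measure" where
  "normal_measure \<mu> \<sigma>2 =
     (if \<sigma>2 = 0 then return borel \<mu> else density lborel (normal_density \<mu> (sqrt \<sigma>2)))"

text \<open>The requirement \<open>0 \<le> \<sigma>2\<close> is needed because \<open>sqrt\<close> is odd on the reals, so
  \<open>normal_measure\<close> is also a probability measure for negative \<open>\<sigma>2\<close>.\<close>

definition normally_distributed ::
    "'w measure \<Rightarrow> ('w \<Rightarrow> real) \<Rightarrow> real \<Rightarrow> real \<Rightarrow> bool" where
  "normally_distributed P X \<mu> \<sigma>2 \<longleftrightarrow>
     X \<in> borel_measurable P \<and> 0 \<le> \<sigma>2 \<and> distr P borel X = normal_measure \<mu> \<sigma>2"

text \<open>\<open>X \<sim> N\<^sub>n(\<mu>, \<Sigma>)\<close>, possibly degenerate: all linear combinations of the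
  components are normal with the corresponding mean and variance.\<close>

definition multivariate_normal ::
    "'w measure \<Rightarrow> nat \<Rightarrow> ('w \<Rightarrow> real vec) \<Rightarrow> real vec \<Rightarrow> real mat \<Rightarrow> bool" where
  "multivariate_normal P n X \<mu> \<Sigma> \<longleftrightarrow>
     (\<forall>\<omega>\<in>space P. X \<omega> \<in> carrier_vec n) \<and>
     \<mu> \<in> carrier_vec n \<and> \<Sigma> \<in> carrier_mat n n \<and> transpose_mat \<Sigma> = \<Sigma> \<and>
     (\<forall>a\<in>carrier_vec n.
        normally_distributed P (\<lambda>\<omega>. scalar_prod a (X \<omega>))
          (scalar_prod a \<mu>) (scalar_prod a (\<Sigma> *\<^sub>v a)))"

definition centered_gaussian_process ::
    "'w measure \<Rightarrow> 'a set \<Rightarrow> ('a \<Rightarrow> 'w \<Rightarrow> real) \<Rightarrow> ('a \<Rightarrow> 'a \<Rightarrow> real) \<Rightarrow> bool" where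
  "centered_gaussian_process P D y C \<longleftrightarrow>
     (\<forall>A. distinct A \<and> set A \<subseteq> D \<longrightarrow>
        multivariate_normal P (length A)
          (\<lambda>\<omega>. Matrix.vec (length A) (\<lambda>i. y (A ! i) \<omega>)) (0\<^sub>v (length A)) (kernel_mat C A A))"

text \<open>Vectors of length \<open>r m\<close> are regarded as elements of the product space
  \<open>\<real>\<^bsup>{0..<r m}\<^esup>\<close> with its Borel sets.\<close>

definition indep_vectors ::
    "'w measure \<Rightarrow> (nat \<Rightarrow> nat) \<Rightarrow> (nat \<Rightarrow> 'w \<Rightarrow> real vec) \<Rightarrow> nat set \<Rightarrow> bool" where
  "indep_vectors P r X I \<longleftrightarrow>
     prob_space.indep_vars P (\<lambda>m. PiM {0..<r m} (\<lambda>_. borel))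
       (\<lambda>m \<omega>. \<lambda>i\<in>{0..<r m}. vec_index (X m \<omega>) i) I"

definition covariance :: "'w measure \<Rightarrow> ('w \<Rightarrow> real) \<Rightarrow> ('w \<Rightarrow> real) \<Rightarrow> real" where
  "covariance P X Y =
     integral\<^sup>L P (\<lambda>\<omega>. (X \<omega> - integral\<^sup>L P X) * (Y \<omega> - integral\<^sup>L P Y))"

definition covariance_function ::
    "'w measure \<Rightarrow> ('a \<Rightarrow> 'w \<Rightarrow> real) \<Rightarrow> 'a \<Rightarrow> 'a \<Rightarrow> real" where
  "covariance_function P y s t = covariance P (y s) (y t)"


section \<open>The multi-resolution approximation\<close>

fun mra_v :: "('a \<Rightarrow> 'a \<Rightarrow> real) \<Rightarrow> (nat \<Rightarrow> 'a \<Rightarrow> 'a \<Rightarrow> real) \<Rightarrow> (nat \<Rightarrow> 'a list) \<Rightarrow>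
    nat \<Rightarrow> 'a \<Rightarrow> 'a \<Rightarrow> real" where
  "mra_v C0 T Q 0 s1 s2 = C0 s1 s2 * T 0 s1 s2"
| "mra_v C0 T Q (Suc m) s1 s2 =
     (mra_v C0 T Q m s1 s2 -
        scalar_prod (kernel_vec (mra_v C0 T Q m) s1 (Q m))
          (inv_mat (kernel_mat (mra_v C0 T Q m) (Q m) (Q m)) *\<^sub>v
             kernel_vec (mra_v C0 T Q m) s2 (Q m))) * T (Suc m) s1 s2"

definition mra_b :: "('a \<Rightarrow> 'a \<Rightarrow> real) \<Rightarrow> (nat \<Rightarrow> 'a \<Rightarrow> 'a \<Rightarrow> real) \<Rightarrow> (nat \<Rightarrow> 'a list) \<Rightarrow>
    nat \<Rightarrow> 'a \<Rightarrow> real vec" where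
  "mra_b C0 T Q m s = kernel_vec (mra_v C0 T Q m) s (Q m)"

definition mra_\<Lambda> :: "('a \<Rightarrow> 'a \<Rightarrow> real) \<Rightarrow> (nat \<Rightarrow> 'a \<Rightarrow> 'a \<Rightarrow> real) \<Rightarrow> (nat \<Rightarrow> 'a list) \<Rightarrow>
    nat \<Rightarrow> real mat" where
  "mra_\<Lambda> C0 T Q m = kernel_mat (mra_v C0 T Q m) (Q m) (Q m)"

definition mra_process :: "('a \<Rightarrow> 'a \<Rightarrow> real) \<Rightarrow> (nat \<Rightarrow> 'a \<Rightarrow> 'a \<Rightarrow> real) \<Rightarrow> (nat \<Rightarrow> 'a list) \<Rightarrow>
    nat \<Rightarrow> (nat \<Rightarrow> 'w \<Rightarrow> real vec) \<Rightarrow> 'a \<Rightarrow> 'w \<Rightarrow> real" where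
  "mra_process C0 T Q M \<eta> s \<omega> = (\<Sum>m\<le>M. scalar_prod (mra_b C0 T Q m s) (\<eta> m \<omega>))"

end

theory Submission
  imports Defs
begin

text \<open>Independence of the \<open>\<eta>\<^sub>m\<close> makes the variance of \<open>y\<^sub>M(s)\<close> the sum of the terms
  \<open>b\<^sub>m(s)' \<Lambda>\<^sub>m\<^sup>-\<^sup>1 b\<^sub>m(s)\<close>. Since every \<open>T\<^sub>m\<close> is 1 on the diagonal, the \<open>m\<close>-th term is
  \<open>v\<^sub>m(s, s) - v\<^sub>m\<^sub>+\<^sub>1(s, s)\<close> and the sum telescopes. If \<open>s\<close> is a knot of level \<open>j\<close>, then \<open>b\<^sub>j(s)'\<close>
  is a row of \<open>\<Lambda>\<^sub>j\<close>, so the interpolant at level \<open>j\<close> reproduces \<open>v\<^sub>j(s, \<cdot>)\<close>; hence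
  \<open>v\<^sub>m(s, \<cdot>)\<close> and \<open>b\<^sub>m(s)\<close> vanish for all \<open>m > j\<close>.\<close>

section \<open>Variances\<close>

lemma normal_measure_moments:
  assumes "0 \<le> \<sigma>2"
  shows "integrable (normal_measure \<mu> \<sigma>2) (\<lambda>x. x)"
    and "integrable (normal_measure \<mu> \<sigma>2) (\<lambda>x. x\<^sup>2)"
    and "integral\<^sup>L (normal_measure \<mu> \<sigma>2) (\<lambda>x. x) = \<mu>"
    and "integral\<^sup>L (normal_measure \<mu> \<sigma>2) (\<lambda>x. (x - \<mu>)\<^sup>2) = \<sigma>2"
proof -
  have "integrable (normal_measure \<mu> \<sigma>2) (\<lambda>x. x) \<and> integrable (normal_measure \<mu> \<sigma>2) (\<lambda>x. x\<^sup>2) \<and>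
    integral\<^sup>L (normal_measure \<mu> \<sigma>2) (\<lambda>x. x) = \<mu> \<and>
    integral\<^sup>L (normal_measure \<mu> \<sigma>2) (\<lambda>x. (x - \<mu>)\<^sup>2) = \<sigma>2"
  proof (cases "\<sigma>2 = 0")
    case True
    interpret prob_space "return borel \<mu>" by (rule prob_space_return) simp
    \<comment> \<open>A point mass sees only the value at \<open>\<mu>\<close>, so
      \<open>\<bar>f \<mu>\<bar>\<close> bounds \<open>f\<close> almost everywhere.\<close>
    have int: "integrable (return borel \<mu>) f" if "f \<in> borel_measurable borel" for f :: "real \<Rightarrow> real"
    proof (rule integrable_const_bound)
      show "AE x in return borel \<mu>. norm (f x) \<le> \<bar>f \<mu>\<bar>"
        using that by (subst AE_return) auto
    qed (use that in simp)
    have "integrable (return borel \<mu>) (\<lambda>x. x)" "integrable (return borel \<mu>) (\<lambda>x. x\<^sup>2)"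
      by (rule int; simp)+
    moreover have "integral\<^sup>L (return borel \<mu>) (\<lambda>x. x) = \<mu>"
      "integral\<^sup>L (return borel \<mu>) (\<lambda>x. (x - \<mu>)\<^sup>2) = 0"
      by (subst integral_return; simp)+
    ultimately show ?thesis using True by (simp add: normal_measure_def)
  next
    case False
    define \<sigma> where "\<sigma> = sqrt \<sigma>2"
    have \<sigma>: "0 < \<sigma>" "\<sigma>\<^sup>2 = \<sigma>2" using False assms by (auto simp: \<sigma>_def)
    let ?d = "normal_density \<mu> \<sigma>"
    have N: "normal_measure \<mu> \<sigma>2 = density lborel ?d"
      using False by (simp add: normal_measure_def \<sigma>_def)
    \<comment> \<open>The available second moment is the central one; the raw one comes from x^2 =
      (x - \<mu>)^2 + 2 \<mu> x - \<mu>^2.\<close>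
    have "integrable lborel (\<lambda>x. ?d x * (x - \<mu>)\<^sup>2 + (2 * \<mu> * (?d x * x) - \<mu>\<^sup>2 * ?d x))"
      using integrable_normal_moment[OF \<sigma>(1), of \<mu> 2]
        integrable_normal_moment_nz_1[OF \<sigma>(1), of \<mu>] integrable_normal_density[OF \<sigma>(1), of \<mu>]
      by (intro Bochner_Integration.integrable_add Bochner_Integration.integrable_diff
          integrable_mult_right) auto
    also have "(\<lambda>x. ?d x * (x - \<mu>)\<^sup>2 + (2 * \<mu> * (?d x * x) - \<mu>\<^sup>2 * ?d x)) = (\<lambda>x. ?d x * x\<^sup>2)"
      by (rule ext) (simp add: power2_eq_square algebra_simps)
    finally have "integrable (density lborel ?d) (\<lambda>x. x\<^sup>2)"
      by (subst integrable_density) simp_all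
    moreover have "integrable (density lborel ?d) (\<lambda>x. x)"
      using integrable_normal_moment_nz_1[OF \<sigma>(1), of \<mu>] by (subst integrable_density) simp_all
    moreover have "integral\<^sup>L (density lborel ?d) (\<lambda>x. x) = \<mu>"
      using integral_normal_moment_nz_1[OF \<sigma>(1), of \<mu>] by (subst integral_density) simp_all
    moreover have "integral\<^sup>L (density lborel ?d) (\<lambda>x. (x - \<mu>)\<^sup>2) = \<sigma>2"
      using integral_normal_moment_even[OF \<sigma>(1), of \<mu> 1] \<sigma>(2)
      by (subst integral_density) (simp_all add: fact_2)
    ultimately show ?thesis unfolding N by blast
  qed
  then show "integrable (normal_measure \<mu> \<sigma>2) (\<lambda>x. x)"
    and "integrable (normal_measure \<mu> \<sigma>2) (\<lambda>x. x\<^sup>2)"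
    and "integral\<^sup>L (normal_measure \<mu> \<sigma>2) (\<lambda>x. x) = \<mu>"
    and "integral\<^sup>L (normal_measure \<mu> \<sigma>2) (\<lambda>x. (x - \<mu>)\<^sup>2) = \<sigma>2"
    by blast+
qed

text \<open>Needed because the random vectors have their prescribed dimension on
  \<open>space P\<close> only, so rewritten scalar products agree only there.\<close>

lemma covariance_cong:
  assumes "\<And>\<omega>. \<omega> \<in> space P \<Longrightarrow> X \<omega> = X' \<omega>" and "\<And>\<omega>. \<omega> \<in> space P \<Longrightarrow> Y \<omega> = Y' \<omega>"
  shows "covariance P X Y = covariance P X' Y'"
proof -
  have "integral\<^sup>L P X = integral\<^sup>L P X'"
    by (rule Bochner_Integration.integral_cong) (simp_all add: assms)
  moreover have "integral\<^sup>L P Y = integral\<^sup>L P Y'"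
    by (rule Bochner_Integration.integral_cong) (simp_all add: assms)
  ultimately show ?thesis
    unfolding covariance_def
    by (intro Bochner_Integration.integral_cong) (simp_all only: assms)
qed

lemma normally_distributed_moments:
  assumes "normally_distributed P X \<mu> \<sigma>2"
  shows "integrable P X" and "integrable P (\<lambda>\<omega>. (X \<omega>)\<^sup>2)" and "covariance P X X = \<sigma>2"
proof -
  have X[measurable]: "X \<in> borel_measurable P" and "0 \<le> \<sigma>2"
    and D: "distr P borel X = normal_measure \<mu> \<sigma>2"
    using assms by (auto simp: normally_distributed_def)
  note m = normal_measure_moments[OF \<open>0 \<le> \<sigma>2\<close>, of \<mu>, folded D]
  show "integrable P X" "integrable P (\<lambda>\<omega>. (X \<omega>)\<^sup>2)"
    using m(1,2) by (simp_all add: integrable_distr_eq)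
  have "integral\<^sup>L P X = \<mu>" "integral\<^sup>L P (\<lambda>\<omega>. (X \<omega> - \<mu>)\<^sup>2) = \<sigma>2"
    using m(3,4) by (simp_all add: integral_distr)
  then show "covariance P X X = \<sigma>2"
    by (simp add: covariance_def power2_eq_square)
qed

section \<open>Variance of sums of independent terms\<close>

text \<open>Bienayme's identity: after centering, the square of the sum expands into a double sum in
  which independence annihilates the off-diagonal expectations.\<close>

lemma (in prob_space) covariance_sum_indep_vars:
  fixes X :: "'i \<Rightarrow> 'a \<Rightarrow> real"
  assumes "finite I"
    and indep: "indep_vars (\<lambda>_. borel) X I"
    and int: "\<And>i. i \<in> I \<Longrightarrow> integrable M (X i)"
    and int2: "\<And>i. i \<in> I \<Longrightarrow> integrable M (\<lambda>\<omega>. (X i \<omega>)\<^sup>2)"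
  shows "covariance M (\<lambda>\<omega>. \<Sum>i\<in>I. X i \<omega>) (\<lambda>\<omega>. \<Sum>i\<in>I. X i \<omega>) = (\<Sum>i\<in>I. covariance M (X i) (X i))"
proof -
  define Y where "Y i \<omega> = X i \<omega> - expectation (X i)" for i \<omega>
  have Y: "integrable M (Y i)" "expectation (Y i) = 0" if "i \<in> I" for i
    using int[OF that] by (simp_all add: Y_def[abs_def] prob_space)
  have indepY: "indep_vars (\<lambda>_. borel) Y I"
    unfolding Y_def[abs_def] by (rule indep_vars_compose2[OF indep]) simp
  have YY: "integrable M (\<lambda>\<omega>. Y i \<omega> * Y j \<omega>) \<and>
      expectation (\<lambda>\<omega>. Y i \<omega> * Y j \<omega>) = (if i = j then covariance M (X i) (X i) else 0)"
    if "i \<in> I" "j \<in> I" for i j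
  proof (cases "i = j")
    case True
    have "integrable M (\<lambda>\<omega>. (X i \<omega>)\<^sup>2 - (2 * expectation (X i) * X i \<omega> - (expectation (X i))\<^sup>2))"
      using int[OF that(1)] int2[OF that(1)] by simp
    also have "(\<lambda>\<omega>. (X i \<omega>)\<^sup>2 - (2 * expectation (X i) * X i \<omega> - (expectation (X i))\<^sup>2))
        = (\<lambda>\<omega>. Y i \<omega> * Y i \<omega>)"
      by (auto simp: Y_def power2_eq_square algebra_simps)
    finally have "integrable M (\<lambda>\<omega>. Y i \<omega> * Y i \<omega>)" .
    then show ?thesis using True by (simp add: covariance_def Y_def)
  next
    case False
    \<comment> \<open>On a two-element index set the product rule for expectations gives E(Y_i)
      E(Y_j), and both factors are 0.\<close>
    have "indep_vars (\<lambda>_. borel) Y {i, j}"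
      using indep_vars_subset[OF indepY, of "{i, j}"] that by simp
    then show ?thesis
      using indep_vars_integrable[of "{i, j}" Y] indep_vars_lebesgue_integral[of "{i, j}" Y]
        Y that False
      by auto
  qed
  have "expectation (\<lambda>\<omega>. \<Sum>i\<in>I. X i \<omega>) = (\<Sum>i\<in>I. expectation (X i))"
    using int by simp
  then have "covariance M (\<lambda>\<omega>. \<Sum>i\<in>I. X i \<omega>) (\<lambda>\<omega>. \<Sum>i\<in>I. X i \<omega>)
      = expectation (\<lambda>\<omega>. (\<Sum>i\<in>I. Y i \<omega>) * (\<Sum>i\<in>I. Y i \<omega>))"
    by (simp add: covariance_def Y_def sum_subtractf)
  also have "\<dots> = expectation (\<lambda>\<omega>. \<Sum>i\<in>I. \<Sum>j\<in>I. Y i \<omega> * Y j \<omega>)"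
    by (simp add: sum_product)
  also have "\<dots> = (\<Sum>i\<in>I. \<Sum>j\<in>I. expectation (\<lambda>\<omega>. Y i \<omega> * Y j \<omega>))"
    using YY by (simp add: Bochner_Integration.integral_sum)
  also have "\<dots> = (\<Sum>i\<in>I. \<Sum>j\<in>I. if i = j then covariance M (X i) (X i) else 0)"
    by (intro sum.cong) (auto simp: YY)
  also have "\<dots> = (\<Sum>i\<in>I. covariance M (X i) (X i))"
    using \<open>finite I\<close> by simp
  finally show ?thesis .
qed

text \<open>Fixed linear functionals of independent vectors are independent scalars, so the
  variances add; normality supplies each variance as a quadratic form in
  \<open>\<Sigma> m\<close>.\<close>

lemma covariance_sum_scalar_prod:
  assumes "prob_space P" and "finite I"
    and normal: "\<And>m. m \<in> I \<Longrightarrow> multivariate_normal P (r m) (X m) (\<mu> m) (\<Sigma> m)"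
    and indep: "indep_vectors P r X I"
    and a: "\<And>m. m \<in> I \<Longrightarrow> a m \<in> carrier_vec (r m)"
  shows "covariance P (\<lambda>\<omega>. \<Sum>m\<in>I. scalar_prod (a m) (X m \<omega>)) (\<lambda>\<omega>. \<Sum>m\<in>I. scalar_prod (a m) (X m \<omega>))
    = (\<Sum>m\<in>I. scalar_prod (a m) (\<Sigma> m *\<^sub>v a m))"
proof -
  interpret prob_space P by fact
  have N: "normally_distributed P (\<lambda>\<omega>. scalar_prod (a m) (X m \<omega>))
      (scalar_prod (a m) (\<mu> m)) (scalar_prod (a m) (\<Sigma> m *\<^sub>v a m))" if "m \<in> I" for m
    using normal[OF that] a[OF that] by (auto simp: multivariate_normal_def)
  \<comment> \<open>\<open>Z m\<close> sees \<open>X m\<close> only through its restriction to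
    \<open>{0..<r m}\<close>, the element of the product space whose independence is assumed. It is
    thus a measurable function of that element.\<close>
  define Z where "Z m \<omega> = (\<Sum>i\<in>{0..<r m}. vec_index (a m) i * (\<lambda>i\<in>{0..<r m}. vec_index (X m \<omega>) i) i)"
    for m \<omega>
  have Z: "scalar_prod (a m) (X m \<omega>) = Z m \<omega>" if "m \<in> I" "\<omega> \<in> space P" for m \<omega>
    using normal[OF that(1)] that(2) by (auto simp: Z_def scalar_prod_def multivariate_normal_def)
  have "indep_vars (\<lambda>_. borel) Z I"
    unfolding Z_def[abs_def]
    by (rule indep_vars_compose2[OF indep[unfolded indep_vectors_def],
          where Y = "\<lambda>m f. \<Sum>i\<in>{0..<r m}. vec_index (a m) i * f i"]) measurable
  moreover have "integrable P (Z m)" "integrable P (\<lambda>\<omega>. (Z m \<omega>)\<^sup>2)"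
    and cov: "covariance P (Z m) (Z m) = scalar_prod (a m) (\<Sigma> m *\<^sub>v a m)" if "m \<in> I" for m
  proof -
    note m = normally_distributed_moments[OF N[OF that]]
    show "integrable P (Z m)"
      using m(1) by (rule Bochner_Integration.integrable_cong[THEN iffD1, rotated 2]) (simp_all add: Z that)
    show "integrable P (\<lambda>\<omega>. (Z m \<omega>)\<^sup>2)"
      using m(2) by (rule Bochner_Integration.integrable_cong[THEN iffD1, rotated 2]) (simp_all add: Z that)
    show "covariance P (Z m) (Z m) = scalar_prod (a m) (\<Sigma> m *\<^sub>v a m)"
      unfolding m(3)[symmetric] by (rule covariance_cong) (simp_all add: Z that)
  qed
  ultimately have "covariance P (\<lambda>\<omega>. \<Sum>m\<in>I. Z m \<omega>) (\<lambda>\<omega>. \<Sum>m\<in>I. Z m \<omega>)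
      = (\<Sum>m\<in>I. covariance P (Z m) (Z m))"
    using covariance_sum_indep_vars[OF \<open>finite I\<close>] by blast
  also have "\<dots> = (\<Sum>m\<in>I. scalar_prod (a m) (\<Sigma> m *\<^sub>v a m))"
    using cov by simp
  also have "covariance P (\<lambda>\<omega>. \<Sum>m\<in>I. Z m \<omega>) (\<lambda>\<omega>. \<Sum>m\<in>I. Z m \<omega>)
      = covariance P (\<lambda>\<omega>. \<Sum>m\<in>I. scalar_prod (a m) (X m \<omega>))
          (\<lambda>\<omega>. \<Sum>m\<in>I. scalar_prod (a m) (X m \<omega>))"
    by (rule covariance_cong) (simp_all add: Z)
  finally show ?thesis .
qed


section \<open>The recursion\<close>

text \<open>An invertible matrix is a unit of the ring of square matrices, which excludes the result
  \<open>None\<close> of \<open>mat_inverse\<close>; so \<open>the\<close> is applied to a genuine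
  inverse.\<close>

lemma inv_mat:
  assumes "invertible_mat A" and A: "A \<in> carrier_mat n n"
  shows "inv_mat A \<in> carrier_mat n n" and "A * inv_mat A = 1\<^sub>m n" and "inv_mat A * A = 1\<^sub>m n"
proof -
  obtain B where B: "A * B = 1\<^sub>m n" "B * A = 1\<^sub>m (dim_row B)"
    using assms by (auto simp: invertible_mat_def inverts_mat_def)
  \<comment> \<open>The size of \<open>B\<close> is not given in advance: comparing column counts in
    the two products yields it.\<close>
  then have "B \<in> carrier_mat n n"
    using A by (metis carrier_matD carrier_matI index_mult_mat(2,3) index_one_mat(2,3))
  then have "A \<in> Units (ring_mat TYPE(real) n ())"
    using A B by (auto simp: Units_def ring_mat_def)
  then obtain C where "mat_inverse A = Some C"
    using mat_inverse(1)[OF A] by fastforce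
  with mat_inverse(2)[OF A this]
  show "inv_mat A \<in> carrier_mat n n" "A * inv_mat A = 1\<^sub>m n" "inv_mat A * A = 1\<^sub>m n"
    by (auto simp: inv_mat_def)
qed

text \<open>Transposing \<open>A * inv_mat A = 1\<^sub>m n\<close> makes the transposed inverse a
  left inverse of the symmetric \<open>A\<close>, and a left inverse equals the right
  inverse.\<close>

lemma transpose_inv_mat:
  assumes "invertible_mat A" and A: "A \<in> carrier_mat n n" and sym: "transpose_mat A = A"
  shows "transpose_mat (inv_mat A) = inv_mat A"
proof -
  note inv = inv_mat[OF assms(1,2)]
  have "transpose_mat (inv_mat A) * A = 1\<^sub>m n"
    using transpose_mult[OF A inv(1)] inv(2) sym by simp
  then have "transpose_mat (inv_mat A) * (A * inv_mat A) = inv_mat A"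
    using A inv(1) by (simp flip: assoc_mult_mat[of _ n n _ n _ n])
  then show ?thesis using inv by simp
qed

lemma scalar_prod_symmetric_mat:
  fixes A :: "'a :: comm_ring_1 mat"
  assumes A: "A \<in> carrier_mat n n" and "transpose_mat A = A"
    and u: "u \<in> carrier_vec n" and w: "w \<in> carrier_vec n"
  shows "scalar_prod u (A *\<^sub>v w) = scalar_prod w (A *\<^sub>v u)"
proof -
  have "scalar_prod u (A *\<^sub>v w) = scalar_prod (A *\<^sub>v u) w"
    using transpose_vec_mult_scalar[OF A w u] assms(2) by simp
  also have "\<dots> = scalar_prod w (A *\<^sub>v u)"
    using A u w by (intro comm_scalar_prod[of _ n]) auto
  finally show ?thesis .
qed

section \<open>Kernel matrices and interpolation\<close>

lemma kernel_mat_carrier [simp]: "kernel_mat f A B \<in> carrier_mat (length A) (length B)"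
  by (simp add: kernel_mat_def)

lemma kernel_vec_carrier [simp]: "kernel_vec f s B \<in> carrier_vec (length B)"
  by (simp add: kernel_vec_def)

lemma transpose_kernel_mat:
  assumes "symmetric_kernel D K" and "set A \<subseteq> D"
  shows "transpose_mat (kernel_mat K A A) = kernel_mat K A A"
  using assms by (intro eq_matI) (auto simp: kernel_mat_def symmetric_kernel_def subset_iff)

text \<open>If \<open>s\<close> is the \<open>i\<close>-th knot, its kernel vector is row
  \<open>i\<close> of the kernel matrix. The matrix cancels against its inverse, leaving entry
  \<open>i\<close> of \<open>kernel_vec K t A\<close>, which is \<open>K t s\<close> in this order
  of arguments.\<close>

lemma interpolant_at_knot:
  assumes "invertible_mat (kernel_mat K A A)" and "s \<in> set A"
  shows "scalar_prod (kernel_vec K s A) (inv_mat (kernel_mat K A A) *\<^sub>v kernel_vec K t A) = K t s"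
proof -
  let ?n = "length A" and ?L = "kernel_mat K A A" and ?w = "kernel_vec K t A"
  note inv = inv_mat[OF assms(1) kernel_mat_carrier]
  obtain i where i: "i < ?n" "s = A ! i" using assms(2) by (metis in_set_conv_nth)
  have "kernel_vec K s A = row ?L i"
    using i by (intro eq_vecI) (auto simp: kernel_vec_def kernel_mat_def)
  then have "scalar_prod (kernel_vec K s A) (inv_mat ?L *\<^sub>v ?w)
      = vec_index (?L *\<^sub>v (inv_mat ?L *\<^sub>v ?w)) i"
    using i by (simp add: kernel_mat_def)
  also have "?L *\<^sub>v (inv_mat ?L *\<^sub>v ?w) = ?w"
    using inv by (simp flip: assoc_mult_mat_vec[of _ ?n ?n _ ?n])
  finally show ?thesis using i by (simp add: kernel_vec_def)
qed

section \<open>Symmetry, vanishing and telescoping of the recursive kernels\<close>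

text \<open>By induction the kernel matrix of the previous level is symmetric, hence so are its
  inverse and the correction term. The kernel of level \<open>m\<close> involves \<open>T m\<close>
  but only knots of levels below \<open>m\<close>, hence the different ranges.\<close>

lemma mra_v_symmetric:
  assumes "symmetric_kernel D C0"
    and "\<And>k. k \<le> m \<Longrightarrow> symmetric_kernel D (T k)"
    and "\<And>k. k < m \<Longrightarrow> set (Q k) \<subseteq> D"
    and "\<And>k. k < m \<Longrightarrow> invertible_mat (mra_\<Lambda> C0 T Q k)"
  shows "symmetric_kernel D (mra_v C0 T Q m)"
  using assms(2-)
proof (induction m)
  case 0
  then show ?case using assms(1) by (auto simp: symmetric_kernel_def)
next
  case (Suc m)
  then have IH: "symmetric_kernel D (mra_v C0 T Q m)" by simp
  have "transpose_mat (inv_mat (mra_\<Lambda> C0 T Q m)) = inv_mat (mra_\<Lambda> C0 T Q m)"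
    using Suc.prems transpose_kernel_mat[OF IH]
    by (intro transpose_inv_mat[of _ "length (Q m)"]) (auto simp: mra_\<Lambda>_def)
  moreover have "inv_mat (mra_\<Lambda> C0 T Q m) \<in> carrier_mat (length (Q m)) (length (Q m))"
    using Suc.prems by (intro inv_mat) (auto simp: mra_\<Lambda>_def)
  ultimately have "scalar_prod (kernel_vec f s (Q m)) (inv_mat (mra_\<Lambda> C0 T Q m) *\<^sub>v kernel_vec f t (Q m))
      = scalar_prod (kernel_vec f t (Q m)) (inv_mat (mra_\<Lambda> C0 T Q m) *\<^sub>v kernel_vec f s (Q m))" for f s t
    by (intro scalar_prod_symmetric_mat) auto
  then show ?case
    using IH Suc.prems(1)[of "Suc m"] by (simp add: symmetric_kernel_def flip: mra_\<Lambda>_def)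
qed

lemma mra_v_vanishes:
  assumes sym: "symmetric_kernel D C0"
    and T: "\<And>k. k \<le> j \<Longrightarrow> symmetric_kernel D (T k)"
    and Q: "\<And>k. k < m \<Longrightarrow> set (Q k) \<subseteq> D"
    and inv: "\<And>k. k < m \<Longrightarrow> invertible_mat (mra_\<Lambda> C0 T Q k)"
    and s: "s \<in> set (Q j)" and "j < m" and t: "t \<in> D"
  shows "mra_v C0 T Q m s t = 0"
  using Suc_leI[OF \<open>j < m\<close>] Q inv t
proof (induction m arbitrary: t rule: dec_induct)
  case base
  \<comment> \<open>Interpolation returns the value at \<open>(t, s)\<close>; symmetry is what lets
    it cancel the value at \<open>(s, t)\<close> in the recursion.\<close>
  have "symmetric_kernel D (mra_v C0 T Q j)"
    using base by (intro mra_v_symmetric sym T) auto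
  then have "mra_v C0 T Q j t s = mra_v C0 T Q j s t"
    using base s by (auto simp: symmetric_kernel_def)
  moreover have "invertible_mat (kernel_mat (mra_v C0 T Q j) (Q j) (Q j))"
    using base(2)[of j] by (simp add: mra_\<Lambda>_def)
  ultimately show ?case by (simp add: interpolant_at_knot[OF _ s])
next
  case (step m)
  have 0: "mra_v C0 T Q m s t = 0" if "t \<in> D" for t
    using step that by simp
  have "kernel_vec (mra_v C0 T Q m) s (Q m) = 0\<^sub>v (length (Q m))"
    using step.prems(1)[of m] by (intro eq_vecI) (auto simp: kernel_vec_def 0 subset_iff)
  moreover have "inv_mat (mra_\<Lambda> C0 T Q m) \<in> carrier_mat (length (Q m)) (length (Q m))"
    using step.prems by (intro inv_mat) (auto simp: mra_\<Lambda>_def)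
  ultimately show ?case
    using step.prems 0 by (auto simp flip: mra_\<Lambda>_def intro!: scalar_prod_left_zero[of _ "length (Q m)"])
qed

text \<open>On the diagonal the recursion reads off each summand as a difference of consecutive
  kernels, and \<open>T 0 s s = 1\<close> makes the initial value \<open>C0 s s\<close>. The range
  includes \<open>k = m\<close> because the last kernel carries the factor
  \<open>T m\<close>.\<close>

lemma sum_mra_telescope:
  assumes "\<And>k. k \<le> m \<Longrightarrow> T k s s = 1"
  shows "(\<Sum>k<m. scalar_prod (mra_b C0 T Q k s) (inv_mat (mra_\<Lambda> C0 T Q k) *\<^sub>v mra_b C0 T Q k s))
    = C0 s s - mra_v C0 T Q m s s"
  using assms by (induction m) (simp_all add: mra_b_def mra_\<Lambda>_def)

section \<open>The variance at a knot\<close>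

theorem proposition3:
  fixes D :: "(real ^ 'd) set"
    and C0 :: "real ^ 'd \<Rightarrow> real ^ 'd \<Rightarrow> real"
    and P0 :: "'u measure" and y0 :: "real ^ 'd \<Rightarrow> 'u \<Rightarrow> real"
    and M :: nat
    and Q :: "nat \<Rightarrow> (real ^ 'd) list"
    and T :: "nat \<Rightarrow> real ^ 'd \<Rightarrow> real ^ 'd \<Rightarrow> real"
    and P :: "'w measure" and \<eta> :: "nat \<Rightarrow> 'w \<Rightarrow> real vec"
    and yM :: "real ^ 'd \<Rightarrow> 'w \<Rightarrow> real"
    and CM :: "real ^ 'd \<Rightarrow> real ^ 'd \<Rightarrow> real"
    and s :: "real ^ 'd"
  assumes "pos_definite_kernel D C0"
    and "prob_space P0"
    and "centered_gaussian_process P0 D y0 C0"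
    and "\<And>m. m \<le> M \<Longrightarrow> distinct (Q m) \<and> set (Q m) \<subseteq> D"
    and "\<And>m. m < M \<Longrightarrow> length (Q m) < length (Q (Suc m))"
    and "\<And>m. m \<le> M \<Longrightarrow> modulating_function D (T m)"
    and "\<And>m. m \<le> M \<Longrightarrow> invertible_mat (mra_\<Lambda> C0 T Q m)"
    and "prob_space P"
    and "\<And>m. m \<le> M \<Longrightarrow> multivariate_normal P (length (Q m)) (\<eta> m)
           (0\<^sub>v (length (Q m))) (inv_mat (mra_\<Lambda> C0 T Q m))"
    and "indep_vectors P (\<lambda>m. length (Q m)) \<eta> {0..M}"
    and "yM = mra_process C0 T Q M \<eta>"
    and "CM = covariance_function P yM"
    and "s \<in> (\<Union>m\<le>M. set (Q m))"
  shows "CM s s = C0 s s"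
proof -
  let ?q = "\<lambda>m. scalar_prod (mra_b C0 T Q m s) (inv_mat (mra_\<Lambda> C0 T Q m) *\<^sub>v mra_b C0 T Q m s)"
  obtain j where j: "j \<le> M" "s \<in> set (Q j)" using assms(13) by auto
  have sD: "s \<in> D" using assms(4) j by auto
  have sym: "symmetric_kernel D C0" using assms(1) by (simp add: pos_definite_kernel_def)
  have symT: "symmetric_kernel D (T m)" and T1: "T m s s = 1" if "m \<le> M" for m
    using assms(6)[OF that] sD by (auto simp: modulating_function_def nonneg_definite_kernel_def)
  have inv: "inv_mat (mra_\<Lambda> C0 T Q m) \<in> carrier_mat (length (Q m)) (length (Q m))"
    if "m \<le> M" for m
    using assms(7)[OF that] by (intro inv_mat) (auto simp: mra_\<Lambda>_def)
  have b0: "?q m = 0" if "m \<in> {..M} - {..j}" for m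
  proof -
    have "mra_v C0 T Q m s t = 0" if "t \<in> D" for t
      using assms(4,7) symT j \<open>m \<in> {..M} - {..j}\<close> that
      by (intro mra_v_vanishes[OF sym, of j]) auto
    then have "mra_b C0 T Q m s = 0\<^sub>v (length (Q m))"
      using assms(4)[of m] that
      by (intro eq_vecI) (auto simp: mra_b_def kernel_vec_def subset_iff)
    then show ?thesis using inv[of m] that by (auto intro!: scalar_prod_left_zero[of _ "length (Q m)"])
  qed
  have "CM s s = (\<Sum>m\<in>{0..M}. ?q m)"
    unfolding assms(11,12) covariance_function_def mra_process_def[abs_def] atLeast0AtMost[symmetric]
    using assms(9,10)
    by (intro covariance_sum_scalar_prod[OF assms(8)]) (auto simp: mra_b_def)
  also have "\<dots> = (\<Sum>m\<le>j. ?q m)"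
    using b0 j by (intro sum.mono_neutral_right) (auto simp: not_le)
  \<comment> \<open>Level \<open>j\<close> is split off and evaluated by interpolation. Telescoping
    through it would involve \<open>T (Suc j)\<close>, about which nothing is known when
    \<open>j = M\<close>.\<close>
  also have "\<dots> = (\<Sum>m<j. ?q m) + ?q j"
    by (simp add: lessThan_Suc_atMost[symmetric])
  also have "(\<Sum>m<j. ?q m) = C0 s s - mra_v C0 T Q j s s"
    using T1 j by (intro sum_mra_telescope) auto
  also have "?q j = mra_v C0 T Q j s s"
    using interpolant_at_knot[OF _ j(2)] assms(7)[OF j(1)] by (simp add: mra_b_def mra_\<Lambda>_def)
  finally show ?thesis by simp
qed

end
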